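(* Let $X$ be a complex Banach space, let $p\ge 2$ (with $p<\infty$) and let $N\in\mathbb{N}$. Then $X$ is $p$-uniformly $\mathbb{C}$-convex of order $N$ if, and only if, $\widetilde{R}_{p,N}(X)>0$.
   Context: Let $\mathbb{D}=\{z\in\mathbb{C}:|z|<1\}$ and $\mathbb{N}=\{1,2,\dots\}$. For a complex Banach space $X$, $H^{\infty}(\mathbb{D},X)$ is the space of bounded holomorphic functions $f:\mathbb{D}\to X$ with norm $\|f\|_{H^\infty(\mathbb{D},X)}=\sup_{|z|<1}\|f(z)\|$; write $f(z)=\sum_{k=0}^\infty x_kz^k$ with $x_k\in X$. The $p$-Bohr radius of order $N$ of $X$ ($1\le p<\infty$, $N\in\mathbb{N}$) is $\widetilde{R}_{p,N}(X)=\inf\{\widetilde{R}_{p,N}(f,X): \|f\|_{H^\infty(\mathbb{D},X)}\le 1\}$, where for $f(z)=\sum_{k=0}^\infty x_kz^k$ with $\|f\|_{H^\infty(\mathbb{D},X)}\le 1$, $\widetilde{R}_{p,N}(f,X)=\sup\{r\ge 0:\|x_0\|^p+\sum_{k=1}^N\|x_k\|^pr^{pk}\le 1\}$. Equivalently, it is the supremum of all $r\ge0$ such that $\left(\sum_{k=0}^N\|x_k\|^pr^{pk}\right)^{1/p}\le\|f\|_{H^\infty(\mathbb{D},X)}$ for every $f(z)=\sum_{k=0}^\infty x_kz^k\in H^\infty(\mathbb{D},X)$. For $2\le p<\infty$, $X$ is called $p$-uniformly $\mathbb{C}$-convex of order $N$ if there exists a constant $\lambda>0$ such that $$\left(\|x_0\|^p+\lambda\|x_1\|^p+\lambda^2\|x_2\|^p+\cdots+\lambda^N\|x_N\|^p\right)^{1/p}\le\max_{\theta\in[0,2\pi)}\left\|x_0+\sum_{k=1}^Ne^{i\theta}x_k\right\|$$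 for all $x_0,x_1,\dots,x_N\in X$.
   Formalization: In the definition of p-uniform C-convexity of order N, the factor of x_k is taken to be e^{ikθ} instead of the printed e^{iθ}; with e^{iθ} in every summand the claim fails for N ≥ 2 (X = C, p = 2, x_0 = 0, x_1 = -x_2 ≠ 0). *)

theory Defs
  imports "HOL-Analysis.Analysis"
begin

text \<open>
  The libraries only provide real Banach spaces. A complex Banach space is a
  Banach space (class \<open>banach\<close>) with a complex scalar multiplication extending the
  real one and for which the norm is homogeneous.
\<close>

class complex_banach = banach +
  fixes scaleC :: "complex \<Rightarrow> 'a \<Rightarrow> 'a"  (infixr "*\<^sub>C" 75)
  assumes scaleC_add_right: "a *\<^sub>C (x + y) = a *\<^sub>C x + a *\<^sub>C y"
    and scaleC_add_left: "(a + b) *\<^sub>C x = a *\<^sub>C x + b *\<^sub>C x"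
    and scaleC_scaleC: "a *\<^sub>C (b *\<^sub>C x) = (a * b) *\<^sub>C x"
    and scaleC_one: "1 *\<^sub>C x = x"
    and scaleC_of_real: "complex_of_real r *\<^sub>C x = r *\<^sub>R x"
    and norm_scaleC: "norm (a *\<^sub>C x) = cmod a * norm x"

instantiation complex :: complex_banach
begin

definition scaleC_complex :: "complex \<Rightarrow> complex \<Rightarrow> complex"
  where "scaleC_complex a x = a * x"

instance
  by standard (simp_all add: scaleC_complex_def algebra_simps norm_mult scaleR_conv_of_real)

end

definition vholomorphic_on :: "(complex \<Rightarrow> 'a::complex_banach) \<Rightarrow> complex set \<Rightarrow> bool"
    (infix "vholomorphic'_on" 50)
  where "f vholomorphic_on S \<longleftrightarrow>
    (\<forall>z\<in>S. \<exists>D. ((\<lambda>w. inverse (w - z) *\<^sub>C (f w - f z)) \<longlongrightarrow> D) (at z within S))"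

text \<open>
  Elements of \<open>H\<^sup>\<infinity>(\<bbbD>, X)\<close> are represented by functions on all of the complex plane;
  their values outside the open unit disc are irrelevant.
\<close>

definition Hinf :: "(complex \<Rightarrow> 'a::complex_banach) set"
  where "Hinf = {f. f vholomorphic_on ball 0 1 \<and> bounded (f ` ball 0 1)}"

definition Hinf_norm :: "(complex \<Rightarrow> 'a::complex_banach) \<Rightarrow> real"
  where "Hinf_norm f = (SUP z\<in>ball 0 1. norm (f z))"

definition has_expansion :: "(complex \<Rightarrow> 'a::complex_banach) \<Rightarrow> (nat \<Rightarrow> 'a) \<Rightarrow> bool"
  where "has_expansion f x \<longleftrightarrow> (\<forall>z\<in>ball 0 1. (\<lambda>k. (z ^ k) *\<^sub>C x k) sums f z)"

text \<open>
  \<open>bohr_radius_of p N x\<close> is the radius of the single function \<open>f\<close> with Taylor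
  coefficients \<open>x\<close>. The supremum may be infinite (e.g. for constant \<open>f\<close>), so it is taken
  in \<^typ>\<open>ennreal\<close>.
\<close>

definition bohr_radius_of :: "real \<Rightarrow> nat \<Rightarrow> (nat \<Rightarrow> 'a::complex_banach) \<Rightarrow> ennreal"
  where "bohr_radius_of p N x =
    Sup {ennreal r | r. 0 \<le> r \<and>
      norm (x 0) powr p + (\<Sum>k=1..N. norm (x k) powr p * r powr (p * real k)) \<le> 1}"

text \<open>
  Every \<open>f \<in> Hinf\<close> has exactly one coefficient sequence \<open>x\<close>, so binding \<open>x\<close> together
  with \<open>f\<close> below gives the infimum over all of the unit ball of \<open>Hinf\<close>.
\<close>

definition bohr_radius :: "real \<Rightarrow> nat \<Rightarrow> 'a::complex_banach itself \<Rightarrow> ennreal"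
  where "bohr_radius p N (X :: 'a itself) =
    Inf {bohr_radius_of p N x | (f :: complex \<Rightarrow> 'a) x.
      f \<in> Hinf \<and> Hinf_norm f \<le> 1 \<and> has_expansion f x}"

text \<open>
  The exponential factor of the \<open>k\<close>-th summand is \<open>e\<^sup>i\<^sup>k\<^sup>\<theta>\<close>, so that the right-hand side is
  the maximum modulus on the unit circle of the polynomial with coefficients
  \<open>x 0, \<dots>, x N\<close>. (With the same factor \<open>e\<^sup>i\<^sup>\<theta>\<close> for every \<open>k\<close>, no nonzero space would
  satisfy the condition for \<open>N \<ge> 2\<close>: take \<open>x 0 = 0\<close>, \<open>x 2 = - x 1 \<noteq> 0\<close>, and all
  other coefficients 0.)
  The supremum is a maximum, by continuity and periodicity in \<open>\<theta>\<close>.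
\<close>

definition unif_C_convex :: "real \<Rightarrow> nat \<Rightarrow> 'a::complex_banach itself \<Rightarrow> bool"
  where "unif_C_convex p N (X :: 'a itself) \<longleftrightarrow>
    (\<exists>c>0. \<forall>x :: nat \<Rightarrow> 'a.
      (norm (x 0) powr p + (\<Sum>k=1..N. c ^ k * norm (x k) powr p)) powr (1 / p)
        \<le> (SUP \<theta>\<in>{0..<2 * pi}. norm (x 0 + (\<Sum>k=1..N. cis (real k * \<theta>) *\<^sub>C x k))))"

end

(* If X is uniformly convex, apply the convexity inequality to the N-th Fejer mean of f on the
   circle of radius 1/2: it is a polynomial of degree N whose sup norm is at most that of f, and
   its k-th coefficient is x_k up to a positive factor, equal to 1 for k = 0. Conversely, by the
   maximum modulus principle a polynomial divided by any bound for it on the circle lies in the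
   unit ball of H^infinity, and a Bohr radius r gives the convexity constant r^p. Both tools are
   obtained by averaging over roots of unity, which avoids vector-valued integration. *)

theory Submission
  imports Defs
begin

section \<open>Complex scalar multiplication as a real bounded linear map\<close>

text \<open>Real linearity in each argument suffices to move sums, differences, limits and
  continuity through \<open>scaleC\<close>.\<close>

lemma bounded_linear_scaleC_left: "bounded_linear (\<lambda>a. a *\<^sub>C (x::'a::complex_banach))"
proof
  fix r :: real and a b :: complex
  show "(a + b) *\<^sub>C x = a *\<^sub>C x + b *\<^sub>C x" by (rule scaleC_add_left)
  show "(r *\<^sub>R a) *\<^sub>C x = r *\<^sub>R (a *\<^sub>C x)"
    by (simp add: scaleC_of_real[of r "a *\<^sub>C x", symmetric] scaleC_scaleC scaleR_conv_of_real)
  show "\<exists>K. \<forall>a. norm (a *\<^sub>C x) \<le> norm a * K" by (auto simp: norm_scaleC)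
qed

lemma bounded_linear_scaleC_right: "bounded_linear (\<lambda>x::'a::complex_banach. a *\<^sub>C x)"
proof
  fix r :: real and x y :: 'a
  show "a *\<^sub>C (x + y) = a *\<^sub>C x + a *\<^sub>C y" by (rule scaleC_add_right)
  show "a *\<^sub>C (r *\<^sub>R x) = r *\<^sub>R (a *\<^sub>C x)"
    by (simp add: scaleC_of_real[symmetric] scaleC_scaleC mult.commute)
  show "\<exists>K. \<forall>x::'a. norm (a *\<^sub>C x) \<le> norm x * K"
    by (intro exI[of _ "norm a"]) (simp add: norm_scaleC mult.commute)
qed

lemmas scaleC_sum_left = linear_sum[OF bounded_linear.linear[OF bounded_linear_scaleC_left]]
lemmas scaleC_sum_right = linear_sum[OF bounded_linear.linear[OF bounded_linear_scaleC_right]]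
lemmas scaleC_diff_left = linear_diff[OF bounded_linear.linear[OF bounded_linear_scaleC_left]]
lemmas scaleC_zero_left = linear_0[OF bounded_linear.linear[OF bounded_linear_scaleC_left]]

section \<open>Polynomials with vector coefficients\<close>

definition vpoly :: "nat \<Rightarrow> (nat \<Rightarrow> 'a::complex_banach) \<Rightarrow> complex \<Rightarrow> 'a"
  where "vpoly n x z = (\<Sum>k\<le>n. z ^ k *\<^sub>C x k)"

lemma continuous_on_vpoly [continuous_intros]:
  "continuous_on S f \<Longrightarrow> continuous_on S (\<lambda>z. vpoly n x (f z))"
  unfolding vpoly_def
  by (intro continuous_on_sum bounded_linear.continuous_on[OF bounded_linear_scaleC_left]
      continuous_intros)

lemma vholomorphic_on_vpoly: "vpoly n x vholomorphic_on S"
  unfolding vholomorphic_on_def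
proof
  fix z assume "z \<in> S"
  \<comment> \<open>Pulling the quotient inside the sum reduces differentiability to that of the
    scalar monomials.\<close>
  have quotient: "inverse (w - z) *\<^sub>C (vpoly n x w - vpoly n x z)
      = (\<Sum>k\<le>n. ((w ^ k - z ^ k) / (w - z)) *\<^sub>C x k)" for w
    by (simp add: vpoly_def sum_subtractf[symmetric] scaleC_sum_right scaleC_scaleC
        scaleC_diff_left[symmetric] divide_inverse mult.commute)
  have "((\<lambda>w. (w ^ k - z ^ k) / (w - z)) \<longlongrightarrow> of_nat k * z ^ (k - 1)) (at z within S)" for k
    using DERIV_power[OF DERIV_ident, of k z S]
    by (simp add: has_field_derivative_iff)
  then have "((\<lambda>w. inverse (w - z) *\<^sub>C (vpoly n x w - vpoly n x z))
      \<longlongrightarrow> (\<Sum>k\<le>n. (of_nat k * z ^ (k - 1)) *\<^sub>C x k)) (at z within S)"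
    unfolding quotient
    by (intro tendsto_sum bounded_linear.tendsto[OF bounded_linear_scaleC_left])
  then show "\<exists>D. ((\<lambda>w. inverse (w - z) *\<^sub>C (vpoly n x w - vpoly n x z)) \<longlongrightarrow> D) (at z within S)"
    by blast
qed

lemma sums_vpoly: "(\<lambda>k. z ^ k *\<^sub>C (if k \<le> n then x k else 0)) sums vpoly n x z"
proof -
  have "(\<lambda>k. z ^ k *\<^sub>C (if k \<le> n then x k else 0)) sums
      (\<Sum>k\<le>n. z ^ k *\<^sub>C (if k \<le> n then x k else 0))"
    by (intro sums_finite) (auto simp: norm_scaleC simp flip: norm_eq_zero)
  then show ?thesis by (simp add: vpoly_def cong: sum.cong_simp)
qed

section \<open>Discrete orthogonality of roots of unity\<close>

definition root_of_unity :: "nat \<Rightarrow> nat \<Rightarrow> complex"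
  where "root_of_unity M j = cis (2 * pi * real j / real M)"

lemma norm_root_of_unity [simp]: "norm (root_of_unity M j) = 1"
  by (simp add: root_of_unity_def)

lemma root_of_unity_0 [simp]: "root_of_unity M 0 = 1"
  by (simp add: root_of_unity_def)

text \<open>The sum is geometric with a ratio \<open>u\<close> satisfying \<open>u ^ M = 1\<close>.
  If \<open>a\<close> and \<open>b\<close> differ, \<open>u = 1\<close> would make \<open>M\<close>
  divide \<open>a - b\<close>, which is impossible since the difference is smaller than
  \<open>M\<close> in absolute value.\<close>

lemma sum_root_of_unity_orthogonal:
  assumes "a < M" "b < M"
  shows "(\<Sum>j<M. root_of_unity M j ^ a * cnj (root_of_unity M j) ^ b)
    = (if a = b then of_nat M else 0)"
proof -
  define u where "u = cis (2 * pi * (real a - real b) / real M)"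
  have *: "root_of_unity M j ^ a * cnj (root_of_unity M j) ^ b = u ^ j" for j
  proof -
    have "real a * (2 * pi * real j / real M) - real b * (2 * pi * real j / real M)
        = real j * (2 * pi * (real a - real b) / real M)"
      by (simp add: algebra_simps diff_divide_distrib)
    then show ?thesis
      by (simp add: root_of_unity_def u_def cis_cnj Complex.DeMoivre cis_mult)
  qed
  show ?thesis
  proof (cases "a = b")
    case True
    then show ?thesis unfolding * by (simp add: u_def)
  next
    case False
    have "u ^ M = cis (2 * pi * of_int (int a - int b))"
      using assms by (simp add: u_def Complex.DeMoivre)
    also have "\<dots> = 1" by (intro cis_multiple_2pi) simp
    finally have "u ^ M = 1" .
    moreover have "u \<noteq> 1"
    proof
      assume "u = 1"
      then have "exp (\<i> * complex_of_real (2 * pi * (real a - real b) / real M)) = 1"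
        by (simp add: u_def cis_conv_exp)
      then obtain n :: int
        where "2 * pi * (real a - real b) / real M = of_int (2 * n) * pi"
        by (auto simp: exp_eq_1)
      then have "pi * (real a - real b - of_int n * real M) = 0"
        using assms by (simp add: field_simps)
      then have "real a - real b = of_int n * real M" by simp
      then have "real_of_int (int a - int b) = real_of_int (n * int M)" by simp
      then have "int a - int b = n * int M" unfolding of_int_eq_iff .
      then have "int M dvd int a - int b" by simp
      moreover have "\<bar>int a - int b\<bar> < int M" using assms by linarith
      ultimately show False using False zdvd_imp_le[of "int M" "\<bar>int a - int b\<bar>"] by simp
    qed
    ultimately show ?thesis unfolding * using False by (simp add: geometric_sum)
  qed
qed

section \<open>Mean value property and maximum modulus\<close>

text \<open>In the binomial expansion every power of \<open>b\<close> beyond the zeroth averages to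
  zero, because its exponent lies strictly between 0 and \<open>M\<close>. More nodes than the
  degree thus make the discrete mean exact.\<close>

lemma mean_value_power:
  assumes "k < M"
  shows "(\<Sum>j<M. (a + b * root_of_unity M j) ^ k) = of_nat M * a ^ k"
proof -
  have "(\<Sum>j<M. (b * root_of_unity M j + a) ^ k)
      = (\<Sum>i\<le>k. of_nat (k choose i) * b ^ i * a ^ (k - i) * (\<Sum>j<M. root_of_unity M j ^ i))"
    by (simp add: binomial_ring sum_distrib_left power_mult_distrib mult_ac sum.swap[of _ "{..k}"])
  also have "\<dots> = (\<Sum>i\<le>k. if i = 0 then of_nat M * a ^ k else 0)"
    using assms sum_root_of_unity_orthogonal[of _ M 0] by (intro sum.cong) auto
  also have "\<dots> = of_nat M * a ^ k" by simp
  finally show ?thesis by (simp add: add.commute)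
qed

lemma mean_value_vpoly:
  assumes "n < M"
  shows "(\<Sum>j<M. vpoly n x (a + b * root_of_unity M j)) = real M *\<^sub>R vpoly n x a"
proof -
  have "(\<Sum>j<M. vpoly n x (a + b * root_of_unity M j))
      = (\<Sum>k\<le>n. (\<Sum>j<M. (a + b * root_of_unity M j) ^ k) *\<^sub>C x k)"
    by (simp add: vpoly_def scaleC_sum_left sum.swap[of _ "{..<M}"])
  also have "\<dots> = (\<Sum>k\<le>n. of_real (real M) *\<^sub>C a ^ k *\<^sub>C x k)"
    using assms by (intro sum.cong) (auto simp: mean_value_power scaleC_scaleC)
  finally show ?thesis
    by (simp add: vpoly_def scaleC_of_real scaleR_sum_right del: of_real_of_nat_eq)
qed

lemma vpoly_maximum_modulus:
  assumes circle: "\<And>w. norm w = 1 \<Longrightarrow> norm (vpoly n x w) \<le> B" and "norm z \<le> 1"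
  shows "norm (vpoly n x z) \<le> B"
proof -
  have "\<exists>a\<in>cball 0 1. \<forall>y\<in>cball 0 1. norm (vpoly n x y) \<le> norm (vpoly n x a)"
    by (rule continuous_attains_sup) (auto intro!: continuous_intros)
  then obtain a where a: "norm a \<le> 1"
    and max: "\<And>y. norm y \<le> 1 \<Longrightarrow> norm (vpoly n x y) \<le> norm (vpoly n x a)"
    by auto
  \<comment> \<open>The point of the unit circle nearest to \<open>a\<close>. The centre needs a
    separate choice, since \<open>sgn 0 = 0\<close>.\<close>
  define v where "v = (if a = 0 then 1 else sgn a)"
  define b where "b = (1 - norm a) *\<^sub>R v"
  have v: "norm v = 1" "a = norm a *\<^sub>R v"
    by (auto simp: v_def norm_sgn sgn_div_norm)
  have nb: "norm b = 1 - norm a" using v a by (simp add: b_def)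
  have "a + b = v"
    using v(2)
    by (metis b_def add_diff_cancel_left' add.commute diff_add_cancel scaleR_left.add scaleR_one)
  \<comment> \<open>All points of the circle of radius \<open>1 - norm a\<close> around the maximiser \<open>a\<close> are
    maximisers, and one of them, \<open>v\<close>, lies on the unit circle.\<close>
  let ?M = "Suc n"
  let ?g = "\<lambda>j. vpoly n x (a + b * root_of_unity ?M j)"
  have "norm (a + b * root_of_unity ?M j) \<le> 1" for j
    using norm_triangle_ineq[of a "b * root_of_unity ?M j"] nb by (simp add: norm_mult)
  then have g: "norm (?g j) \<le> norm (vpoly n x a)" for j by (rule max)
  have "real ?M * norm (vpoly n x a) = norm (\<Sum>j<?M. ?g j)"
    by (simp only: mean_value_vpoly[of n ?M] lessI norm_scaleR abs_of_nat)
  \<comment> \<open>The node \<open>j = 0\<close> is split off: it is the point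
    \<open>a + b = v\<close>. The other \<open>n\<close> terms are bounded by the maximum and cancel
    against \<open>n\<close> of the \<open>n + 1\<close> copies on the left.\<close>
  also have "\<dots> \<le> norm (vpoly n x v) + (\<Sum>j<n. norm (?g (Suc j)))"
    unfolding sum.lessThan_Suc_shift using \<open>a + b = v\<close>
    by (auto intro!: norm_triangle_le sum_norm_le simp: o_def)
  also have "\<dots> \<le> norm (vpoly n x v) + real n * norm (vpoly n x a)"
    using sum_bounded_above[of "{..<n}" "\<lambda>j. norm (?g (Suc j))"] g by simp
  finally have "norm (vpoly n x a) \<le> norm (vpoly n x v)" by (simp add: algebra_simps)
  with circle[OF v(1)] max[OF assms(2)] show ?thesis by linarith
qed

section \<open>Fejer means of polynomials\<close>

text \<open>These are the weights \<open>1 - k / (N + 1)\<close>; truncated subtraction makes them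
  vanish for \<open>k > N\<close>.\<close>

definition fejer :: "nat \<Rightarrow> nat \<Rightarrow> real"
  where "fejer N k = real (Suc N - k) / real (Suc N)"

text \<open>
  The squared norm is \<open>N + 1\<close> times the Fejer kernel. With \<open>n + N + 1\<close> nodes there is
  no aliasing, so the discrete average computes its exact Fourier coefficients.
\<close>

lemma fejer_kernel_mean:
  fixes N :: nat
  assumes "k \<le> n"
  defines "M \<equiv> n + N + 1"
  shows "(\<Sum>j<M. of_real ((norm (\<Sum>a\<le>N. root_of_unity M j ^ a))\<^sup>2) * cnj (root_of_unity M j) ^ k)
    = of_nat M * of_nat (Suc N - k)"
proof -
  let ?u = "root_of_unity M"
  have "of_real ((norm (\<Sum>a\<le>N. ?u j ^ a))\<^sup>2) * cnj (?u j) ^ k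
      = (\<Sum>a\<le>N. \<Sum>b\<le>N. ?u j ^ a * cnj (?u j) ^ (b + k))" for j
  proof -
    have "of_real ((norm (\<Sum>a\<le>N. ?u j ^ a))\<^sup>2) = (\<Sum>a\<le>N. \<Sum>b\<le>N. ?u j ^ a * cnj (?u j) ^ b)"
      by (simp add: complex_norm_square sum_product del: of_real_power)
    then show ?thesis
      by (simp only: sum_distrib_right power_add mult.assoc)
  qed
  then have "(\<Sum>j<M. of_real ((norm (\<Sum>a\<le>N. ?u j ^ a))\<^sup>2) * cnj (?u j) ^ k)
      = (\<Sum>a\<le>N. \<Sum>b\<le>N. \<Sum>j<M. ?u j ^ a * cnj (?u j) ^ (b + k))"
    by (simp add: sum.swap[of _ _ "{..<M}"])
  also have "\<dots> = (\<Sum>a\<le>N. \<Sum>b\<le>N. if a = b + k then of_nat M else 0)"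
    using assms by (intro sum.cong refl sum_root_of_unity_orthogonal) auto
  also have "\<dots> = (\<Sum>b\<le>N. \<Sum>a\<le>N. if a = b + k then of_nat M else 0)"
    by (rule sum.swap)
  also have "\<dots> = (\<Sum>b\<le>N. if b + k \<le> N then of_nat M else 0)"
    by (intro sum.cong) auto
  \<comment> \<open>There are \<open>N + 1 - k\<close> admissible values of \<open>b\<close>, and
    none if \<open>k > N\<close>, in agreement with truncated subtraction.\<close>
  also have "\<dots> = (\<Sum>b<Suc N - k. of_nat M)"
    by (intro sum.mono_neutral_cong_right) auto
  finally show ?thesis by (simp add: mult.commute)
qed

text \<open>The Fejer mean is a weighted average of values of the original polynomial at rotations
  of \<open>w\<close>. The weights \<open>K\<close> are nonnegative, so a bound on the circle is
  inherited.\<close>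

lemma norm_fejer_vpoly_le:
  assumes circle: "\<And>w. norm w = 1 \<Longrightarrow> norm (vpoly n x w) \<le> B"
    and "N \<le> n" "norm w = 1"
  shows "norm (vpoly N (\<lambda>k. fejer N k *\<^sub>R x k) w) \<le> B"
proof -
  define M where "M = n + N + 1"
  define K where "K j = (norm (\<Sum>a\<le>N. root_of_unity M j ^ a))\<^sup>2" for j
  have K: "(\<Sum>j<M. of_real (K j) * cnj (root_of_unity M j) ^ k) = of_nat M * of_nat (Suc N - k)"
    if "k \<le> n" for k
    using fejer_kernel_mean[OF that, of N] by (simp add: K_def M_def)
  have fejer_Suc: "of_nat (Suc N) * complex_of_real (fejer N k) = of_nat (Suc N - k)" for k
    by (simp add: fejer_def del: of_nat_Suc of_nat_diff)
  have "(\<Sum>j<M. K j *\<^sub>R vpoly n x (w * cnj (root_of_unity M j)))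
      = (\<Sum>j<M. \<Sum>k\<le>n. (of_real (K j) * cnj (root_of_unity M j) ^ k * w ^ k) *\<^sub>C x k)"
    by (simp add: vpoly_def scaleR_sum_right scaleC_of_real[symmetric] scaleC_scaleC
        scaleC_sum_right power_mult_distrib mult_ac)
  also have "\<dots> = (\<Sum>k\<le>n. \<Sum>j<M. (of_real (K j) * cnj (root_of_unity M j) ^ k * w ^ k) *\<^sub>C x k)"
    by (rule sum.swap)
  also have "\<dots> = (\<Sum>k\<le>n. (of_nat M * of_nat (Suc N - k) * w ^ k) *\<^sub>C x k)"
    by (intro sum.cong) (auto simp: K scaleC_sum_left[symmetric] sum_distrib_right[symmetric])
  \<comment> \<open>The factor \<open>Suc N - k\<close> is zero beyond \<open>N\<close>, so
    averaging itself cuts the degree from \<open>n\<close> to \<open>N\<close>.\<close>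
  also have "\<dots> = (\<Sum>k\<le>N. (of_nat M * of_nat (Suc N - k) * w ^ k) *\<^sub>C x k)"
    using \<open>N \<le> n\<close> by (intro sum.mono_neutral_right) (auto simp: scaleC_zero_left)
  also have "\<dots> = (real M * real (Suc N)) *\<^sub>R vpoly N (\<lambda>k. fejer N k *\<^sub>R x k) w"
    unfolding vpoly_def scaleC_of_real[symmetric] scaleC_sum_right scaleC_scaleC
    by (intro sum.cong) (simp_all add: fejer_Suc[symmetric] mult_ac del: of_nat_Suc of_nat_diff)
  finally have mean: "(\<Sum>j<M. K j *\<^sub>R vpoly n x (w * cnj (root_of_unity M j)))
      = (real M * real (Suc N)) *\<^sub>R vpoly N (\<lambda>k. fejer N k *\<^sub>R x k) w" .
  \<comment> \<open>Frequency 0 yields the total mass of the weights, by which the average is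
    normalised.\<close>
  have "complex_of_real (\<Sum>j<M. K j) = of_real (real M * real (Suc N))"
    using K[of 0] by simp
  then have K_sum: "(\<Sum>j<M. K j) = real M * real (Suc N)" by (simp only: of_real_eq_iff)
  have "(real M * real (Suc N)) * norm (vpoly N (\<lambda>k. fejer N k *\<^sub>R x k) w)
      = norm (\<Sum>j<M. K j *\<^sub>R vpoly n x (w * cnj (root_of_unity M j)))"
    unfolding mean by simp
  also have "\<dots> \<le> (\<Sum>j<M. K j * B)"
    using assms(3) by (intro sum_norm_le) (auto simp: K_def norm_mult intro!: mult_left_mono circle)
  also have "\<dots> = (real M * real (Suc N)) * B"
    by (simp only: sum_distrib_right[symmetric] K_sum)
  finally show ?thesis by (simp add: M_def del: of_nat_Suc of_nat_add)
qed

section \<open>From polynomials to power series\<close>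

text \<open>Convergence at some \<open>s\<close> between \<open>r\<close> and 1 bounds the terms
  there, and the terms at \<open>r\<close> are then dominated by a geometric series of ratio
  \<open>r / s\<close>.\<close>

lemma summable_norm_coeffs:
  assumes "has_expansion f x" "0 \<le> r" "r < 1"
  shows "summable (\<lambda>k. norm (r ^ k *\<^sub>R x k))"
proof -
  obtain s where s: "r < s" "s < 1" using dense[OF \<open>r < 1\<close>] by blast
  have "summable (\<lambda>k. of_real s ^ k *\<^sub>C x k)"
    using assms s unfolding has_expansion_def sums_iff by auto
  then have "summable (\<lambda>k. s ^ k *\<^sub>R x k)"
    by (simp add: of_real_power[symmetric] scaleC_of_real del: of_real_power)
  then have "Bseq (\<lambda>k. s ^ k *\<^sub>R x k)"
    using summable_LIMSEQ_zero convergentI convergent_imp_Bseq by blast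
  then obtain C where C: "\<And>k. norm (s ^ k *\<^sub>R x k) \<le> C" unfolding Bseq_def by blast
  have "norm (r ^ k *\<^sub>R x k) \<le> C * (r / s) ^ k" for k
  proof -
    have "norm (r ^ k *\<^sub>R x k) = norm (s ^ k *\<^sub>R x k) * (r / s) ^ k"
      using s assms by (simp add: power_divide)
    also have "\<dots> \<le> C * (r / s) ^ k" using s assms by (intro mult_right_mono C) auto
    finally show ?thesis .
  qed
  moreover have "summable (\<lambda>k. C * (r / s) ^ k)"
    using s assms by (intro summable_mult summable_geometric) auto
  ultimately show ?thesis
    by - (rule summable_comparison_test'[where N = 0], assumption, simp only: real_norm_def abs_norm_cancel)
qed

text \<open>On the circle of radius \<open>r\<close> the partial sums approximate \<open>f\<close>
  uniformly. The polynomial bound applies to a long partial sum, and its Fejer mean of order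
  \<open>N\<close> does not depend on the length.\<close>

lemma norm_fejer_expansion_le:
  assumes exp: "has_expansion f x" and bound: "\<And>z. norm z < 1 \<Longrightarrow> norm (f z) \<le> B"
    and r: "0 \<le> r" "r < 1" and w: "norm w = 1"
  shows "norm (vpoly N (\<lambda>k. (fejer N k * r ^ k) *\<^sub>R x k) w) \<le> B"
proof (rule field_le_epsilon)
  fix e :: real assume "e > 0"
  have summable: "summable (\<lambda>k. norm (r ^ k *\<^sub>R x k))"
    using summable_norm_coeffs[OF exp r] .
  obtain n0 where n0: "\<And>n. n \<ge> n0 \<Longrightarrow> norm (\<Sum>k. norm (r ^ (k + n) *\<^sub>R x (k + n))) < e"
    using suminf_exist_split[OF \<open>e > 0\<close> summable] by blast
  \<comment> \<open>Beyond \<open>n0\<close> the tail is small; \<open>n\<close> must also reach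
    \<open>N\<close> for the Fejer bound to apply.\<close>
  define n where "n = max n0 N"
  have "norm (vpoly n (\<lambda>k. r ^ k *\<^sub>R x k) u) \<le> B + e" if u: "norm u = 1" for u
  proof -
    let ?t = "\<lambda>k. u ^ k *\<^sub>C r ^ k *\<^sub>R x k"
    have nt: "norm (?t k) = norm (r ^ k *\<^sub>R x k)" for k
      by (simp add: norm_scaleC norm_power u)
    have "norm (u * of_real r) < 1" using u r by (simp add: norm_mult)
    then have "(\<lambda>k. (u * of_real r) ^ k *\<^sub>C x k) sums f (u * of_real r)"
      using exp by (simp add: has_expansion_def)
    then have "?t sums f (u * of_real r)"
      by (simp add: power_mult_distrib scaleC_of_real[symmetric] scaleC_scaleC)
    then have "f (u * of_real r) = (\<Sum>k. ?t (k + Suc n)) + vpoly n (\<lambda>k. r ^ k *\<^sub>R x k) u"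
      using suminf_split_initial_segment[of ?t "Suc n"]
      by (simp add: sums_iff vpoly_def lessThan_Suc_atMost)
    moreover have "norm (\<Sum>k. ?t (k + Suc n)) \<le> (\<Sum>k. norm (?t (k + Suc n)))"
      by (intro summable_norm)
        (simp only: nt summable_iff_shift[of "\<lambda>k. norm (r ^ k *\<^sub>R x k)"] summable)
    moreover have "\<dots> \<le> e"
    proof -
      have "n0 \<le> Suc n" by (simp add: n_def)
      from n0[OF this] show ?thesis unfolding nt real_norm_def by linarith
    qed
    ultimately show ?thesis
      using bound[OF \<open>norm (u * of_real r) < 1\<close>]
        norm_triangle_ineq4[of "f (u * of_real r)" "\<Sum>k. ?t (k + Suc n)"] by simp
  qed
  from norm_fejer_vpoly_le[OF this _ w, of N]
  show "norm (vpoly N (\<lambda>k. (fejer N k * r ^ k) *\<^sub>R x k) w) \<le> B + e"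
    by (simp add: n_def)
qed

section \<open>The supremum over the unit circle\<close>

definition circle_norm :: "nat \<Rightarrow> (nat \<Rightarrow> 'a::complex_banach) \<Rightarrow> real"
  where "circle_norm N x =
    (SUP \<theta>\<in>{0..<2 * pi}. norm (x 0 + (\<Sum>k=1..N. cis (real k * \<theta>) *\<^sub>C x k)))"

lemma vpoly_cis: "vpoly N x (cis \<theta>) = x 0 + (\<Sum>k=1..N. cis (real k * \<theta>) *\<^sub>C x k)"
  by (simp add: vpoly_def atMost_atLeast0 sum.atLeast_Suc_atMost Complex.DeMoivre scaleC_one)

lemma circle_norm_le:
  assumes "\<And>w. norm w = 1 \<Longrightarrow> norm (vpoly N x w) \<le> B"
  shows "circle_norm N x \<le> B"
  unfolding circle_norm_def vpoly_cis[symmetric]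
  by (intro cSUP_least assms) auto

lemma norm_vpoly_le_circle_norm:
  assumes "norm w = 1"
  shows "norm (vpoly N x w) \<le> circle_norm N x"
proof -
  \<comment> \<open>Boundedness has to be secured first, as a real supremum is meaningful only for a
    set bounded above.\<close>
  have "compact ((\<lambda>w. norm (vpoly N x w)) ` sphere 0 1)"
    by (intro compact_continuous_image continuous_intros) auto
  then have "bdd_above ((\<lambda>w. norm (vpoly N x w)) ` sphere 0 1)"
    by (intro bounded_imp_bdd_above compact_imp_bounded)
  then have bdd: "bdd_above ((\<lambda>\<theta>. norm (vpoly N x (cis \<theta>))) ` {0..<2 * pi})"
    by (rule bdd_above_mono) auto
  \<comment> \<open>\<open>Arg2pi\<close> takes its values in \<open>{0..<2 * pi}\<close>, the index
    set of the supremum.\<close>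
  have "w = cis (Arg2pi w)"
    using complex_norm_eq_1_exp assms by (auto simp: cis_conv_exp)
  then show ?thesis
    unfolding circle_norm_def vpoly_cis[symmetric]
    using cSUP_upper[OF _ bdd, of "Arg2pi w"] Arg2pi[of w] by simp
qed

section \<open>Bohr radius and convexity constant\<close>

text \<open>The Bohr sum increases with the radius, so the admissible radii of one function are
  downward closed, and any \<open>r\<close> strictly below the infimum is admissible for every
  function.\<close>

lemma bohr_sum_le_one:
  assumes "r0 \<le> bohr_radius p N TYPE('a::complex_banach)" "ennreal r < r0" "0 \<le> r" "0 \<le> p"
    and f: "(f :: complex \<Rightarrow> 'a) \<in> Hinf" "Hinf_norm f \<le> 1" "has_expansion f x"
  shows "norm (x 0) powr p + (\<Sum>k=1..N. norm (x k) powr p * r powr (p * real k)) \<le> 1"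
proof -
  have "bohr_radius p N TYPE('a) \<le> bohr_radius_of p N x"
    unfolding bohr_radius_def using f by (intro Inf_lower) auto
  with assms(1,2) have "ennreal r < bohr_radius_of p N x" by order
  then obtain s where s: "ennreal r < ennreal s" "0 \<le> s"
    "norm (x 0) powr p + (\<Sum>k=1..N. norm (x k) powr p * s powr (p * real k)) \<le> 1"
    unfolding bohr_radius_of_def less_Sup_iff by auto
  have "r \<le> s" using s(1) \<open>0 \<le> r\<close> by (simp add: ennreal_less_iff)
  then have "(\<Sum>k=1..N. norm (x k) powr p * r powr (p * real k))
      \<le> (\<Sum>k=1..N. norm (x k) powr p * s powr (p * real k))"
    using assms(3,4) by (intro sum_mono mult_left_mono powr_mono2) auto
  with s(3) show ?thesis by linarith
qed

lemma bohr_radius_pos_imp_unif_C_convex: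
  assumes "0 < p" and "0 < bohr_radius p N TYPE('a::complex_banach)"
  shows "unif_C_convex p N TYPE('a)"
proof -
  \<comment> \<open>The Bohr radius may be infinite, so a finite positive number below it is
    chosen.\<close>
  obtain r where r: "0 < r" "ennreal r < bohr_radius p N TYPE('a)"
  proof -
    obtain e where e: "0 < e" "e < bohr_radius p N TYPE('a)" using dense[OF assms(2)] by blast
    then have "e \<noteq> top" by auto
    with e that[of "enn2real e"] show ?thesis by (auto simp: enn2real_positive_iff less_top)
  qed
  have "(norm (x 0) powr p + (\<Sum>k=1..N. (r powr p) ^ k * norm (x k) powr p)) powr (1 / p)
      \<le> circle_norm N x" (is "?S powr _ \<le> _") for x :: "nat \<Rightarrow> 'a"
  proof (rule dense_ge)
    \<comment> \<open>A number strictly above the circle norm is positive even for the zero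
      polynomial, so division by \<open>B\<close> is safe.\<close>
    fix B assume "circle_norm N x < B"
    then have circle: "norm (vpoly N x w) \<le> B" if "norm w = 1" for w
      using norm_vpoly_le_circle_norm[OF that, of N x] by linarith
    have "0 \<le> norm (vpoly N x 1)" by simp
    also have "\<dots> \<le> circle_norm N x" by (rule norm_vpoly_le_circle_norm) simp
    finally have "0 < B" using \<open>circle_norm N x < B\<close> by linarith
    define y where "y k = inverse B *\<^sub>R x k" for k
    have y: "vpoly N y z = inverse B *\<^sub>R vpoly N x z" for z
      by (simp add: vpoly_def y_def scaleC_sum_right scaleC_of_real[symmetric] scaleC_scaleC
          mult.commute)
    have ball: "norm (vpoly N y z) \<le> 1" if "norm z < 1" for z
      using vpoly_maximum_modulus[OF circle, of z] that \<open>0 < B\<close>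
      by (simp add: y field_simps)
    have "vpoly N y \<in> Hinf"
      unfolding Hinf_def by (auto intro!: vholomorphic_on_vpoly boundedI ball)
    moreover have "Hinf_norm (vpoly N y) \<le> 1"
      unfolding Hinf_norm_def by (intro cSUP_least) (auto intro!: ball)
    \<comment> \<open>\<open>y\<close> is arbitrary beyond index \<open>N\<close>, so the Taylor
      coefficients are its truncation.\<close>
    moreover have "has_expansion (vpoly N y) (\<lambda>k. if k \<le> N then y k else 0)"
      unfolding has_expansion_def by (auto intro: sums_vpoly)
    ultimately have *: "norm (y 0) powr p + (\<Sum>k=1..N. norm (y k) powr p * r powr (p * real k)) \<le> 1"
      using bohr_sum_le_one[OF order_refl r(2), of "vpoly N y" "\<lambda>k. if k \<le> N then y k else 0"] r(1) assms(1)
      by (simp cong: sum.cong_simp)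
    have ny: "norm (y k) powr p = norm (x k) powr p / B powr p" for k
      using \<open>0 < B\<close> by (simp add: y_def powr_divide flip: divide_inverse_commute)
    \<comment> \<open>This identity turns the Bohr weights into powers of the convexity constant
      \<open>r powr p\<close>.\<close>
    have "r powr (p * real k) = (r powr p) ^ k" for k
      using r(1) by (simp add: powr_powr[symmetric] powr_realpow)
    with * have "?S / B powr p \<le> 1"
      by (simp add: ny sum_divide_distrib add_divide_distrib mult.commute)
    then have "?S \<le> B powr p" using \<open>0 < B\<close> by (simp add: field_simps)
    then have "?S powr (1 / p) \<le> (B powr p) powr (1 / p)"
      using assms(1) by (intro powr_mono2) (auto intro!: add_nonneg_nonneg sum_nonneg)
    then show "?S powr (1 / p) \<le> B" using \<open>0 < B\<close> assms(1) by (simp add: powr_powr)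
  qed
  then show ?thesis
    unfolding unif_C_convex_def circle_norm_def using r(1)
    by (intro exI[of _ "r powr p"]) auto
qed

text \<open>One radius \<open>r\<close>, depending only on \<open>c\<close>, \<open>p\<close> and
  \<open>N\<close>, is admissible for all functions, so the infimum stays at or above it.\<close>

lemma unif_C_convex_imp_bohr_radius_pos:
  assumes "0 < p" and "unif_C_convex p N TYPE('a::complex_banach)"
  shows "0 < bohr_radius p N TYPE('a)"
proof -
  obtain c where "c > 0" and c: "\<And>x :: nat \<Rightarrow> 'a.
      (norm (x 0) powr p + (\<Sum>k=1..N. c ^ k * norm (x k) powr p)) powr (1 / p) \<le> circle_norm N x"
    using assms(2) unfolding unif_C_convex_def circle_norm_def by blast
  define m where "m = c powr (1 / p)"
  \<comment> \<open>The 2 compensates for the circle of radius 1/2, and \<open>Suc N\<close> for the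
    smallest Fejer weight \<open>1 / (N + 1)\<close>.\<close>
  define r where "r = m / (2 * real (Suc N))"
  have "m > 0" using \<open>c > 0\<close> by (simp add: m_def)
  then have "r > 0" by (simp add: r_def)
  have mp: "m powr p = c" using \<open>c > 0\<close> assms(1) by (simp add: m_def powr_powr)
  have coeff: "(r ^ k) powr p \<le> c ^ k * (fejer N k * (1/2) ^ k) powr p" if k: "k \<in> {1..N}" for k
  proof -
    \<comment> \<open>Since \<open>k\<close> is at least 1, the \<open>k\<close>-th power of
      \<open>1 / (N + 1)\<close> is below its first power, hence below every weight up to index
      \<open>N\<close>.\<close>
    have "1 / real (Suc N) ^ k \<le> 1 / real (Suc N) ^ 1"
      using k by (intro divide_left_mono power_increasing) auto
    also have "\<dots> \<le> fejer N k" using k unfolding fejer_def power_one_right by (intro divide_right_mono) auto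
    finally have "1 / real (Suc N) ^ k \<le> fejer N k" .
    then have "m ^ k * (1/2) ^ k * (1 / real (Suc N) ^ k) \<le> m ^ k * (1/2) ^ k * fejer N k"
      using \<open>m > 0\<close> by (intro mult_left_mono) auto
    then have "r ^ k \<le> m ^ k * (fejer N k * (1/2) ^ k)"
      by (simp add: r_def power_divide power_mult_distrib mult_ac del: of_nat_Suc)
    then have "(r ^ k) powr p \<le> (m ^ k * (fejer N k * (1/2) ^ k)) powr p"
      using \<open>r > 0\<close> assms(1) by (intro powr_mono2) auto
    also have "\<dots> = (m ^ k) powr p * (fejer N k * (1/2) ^ k) powr p"
      by (rule powr_mult)
    also have "(m ^ k) powr p = c ^ k"
      using \<open>m > 0\<close> by (simp add: mp[symmetric] powr_realpow[symmetric] powr_powr mult.commute)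
    finally show ?thesis .
  qed
  have "ennreal r \<le> bohr_radius_of p N x"
    if f: "(f :: complex \<Rightarrow> 'a) \<in> Hinf" "Hinf_norm f \<le> 1" and exp: "has_expansion f x" for f x
  proof -
    have bound: "norm (f z) \<le> 1" if "norm z < 1" for z
    proof -
      have "bdd_above ((\<lambda>z. norm (f z)) ` ball 0 1)"
        using f(1) unfolding Hinf_def bounded_iff bdd_above_def by auto
      then have "norm (f z) \<le> Hinf_norm f"
        unfolding Hinf_norm_def using that by (intro cSUP_upper) auto
      with f(2) show ?thesis by linarith
    qed
    \<comment> \<open>Coefficients of the Fejer mean of \<open>f\<close> on the circle of radius
      1/2; any fixed radius in (0, 1) would serve with another \<open>r\<close>.\<close>
    define y where "y k = (fejer N k * (1/2) ^ k) *\<^sub>R x k" for k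
    have y: "norm (y k) powr p = (fejer N k * (1/2) ^ k) powr p * norm (x k) powr p" for k
    proof -
      have "norm (y k) = fejer N k * (1/2) ^ k * norm (x k)"
        by (simp add: y_def fejer_def abs_mult)
      then show ?thesis by (simp only: powr_mult)
    qed
    let ?S = "norm (y 0) powr p + (\<Sum>k=1..N. c ^ k * norm (y k) powr p)"
    have "circle_norm N y \<le> 1"
      unfolding y_def using norm_fejer_expansion_le[OF exp bound] by (intro circle_norm_le) auto
    with c[of y] have "?S powr (1 / p) \<le> 1" by linarith
    then have "?S \<le> 1"
      using assms(1) by (meson gr_one_powr not_le zero_less_divide_1_iff)
    have "norm (x 0) powr p + (\<Sum>k=1..N. norm (x k) powr p * r powr (p * real k)) \<le> ?S"
    proof (intro add_mono sum_mono)
      \<comment> \<open>The constant term must not shrink, and \<open>fejer N 0 = 1\<close> ensures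
        this.\<close>
      show "norm (x 0) powr p \<le> norm (y 0) powr p" by (simp add: y_def fejer_def)
      fix k assume "k \<in> {1..N}"
      have "r powr (p * real k) = (r ^ k) powr p"
        using \<open>r > 0\<close> by (simp add: powr_realpow[symmetric] powr_powr mult.commute)
      with coeff[OF \<open>k \<in> {1..N}\<close>]
      have "norm (x k) powr p * r powr (p * real k)
          \<le> norm (x k) powr p * (c ^ k * (fejer N k * (1/2) ^ k) powr p)"
        by (intro mult_left_mono) auto
      then show "norm (x k) powr p * r powr (p * real k) \<le> c ^ k * norm (y k) powr p"
        by (simp add: y mult_ac)
    qed
    with \<open>?S \<le> 1\<close> \<open>r > 0\<close> show ?thesis
      unfolding bohr_radius_of_def by (intro Sup_upper) auto
  qed
  then have "ennreal r \<le> bohr_radius p N TYPE('a)"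
    unfolding bohr_radius_def by (intro Inf_greatest) auto
  with \<open>r > 0\<close> show ?thesis by (metis ennreal_less_zero_iff less_le_trans)
qed

theorem theorem2p5:
  fixes p :: real and N :: nat
  assumes "2 \<le> p" and "1 \<le> N"
  shows "unif_C_convex p N TYPE('a::complex_banach) \<longleftrightarrow> 0 < bohr_radius p N TYPE('a)"
proof -
  have "0 < p" using assms(1) by simp
  then show ?thesis
    using bohr_radius_pos_imp_unif_C_convex unif_C_convex_imp_bohr_radius_pos by blast
qed

end
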